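(* Let $\alpha,\beta\in[0,1]$ with $\alpha>0$ or $\beta>0$. Then the price of stability of financial network games under priority-proportional strategies with default costs $(\alpha,\beta)$, when firms aim to maximize their total assets, is unbounded: for every $R>0$ there is a financial network (with non-negative external assets and debt contracts only) whose game has price of stability at least $R$.
   Context: Financial network: firms $v_1,\dots,v_n$; each $v_i$ has external assets $e_i\ge 0$; $v_i$ owes $v_j$ the liability $l_{ij}\ge 0$, with $l_{ii}=0$ (both $l_{ij}>0$ and $l_{ji}>0$ are allowed); $L_i=\sum_j l_{ij}$. Default costs $\alpha,\beta\in[0,1]$: a firm in default can use only an $\alpha$ fraction of its external assets and a $\beta$ fraction of its incoming payments (no default costs corresponds to $\alpha=\beta=1$). Priority-proportional strategy: a strategy $s_i$ of $v_i$ is a complete ordering, allowing ties, of its creditors, i.e. an ordered partition of $\{v_j: l_{ij}>0\}$ into priority classes $1,2,\dots$. Write $L_i^{(m)}$ for the total liability of $v_i$ to its $m$-th class, $k_{ij}$ for the index of the class of $v_i$ containing $v_j$, and $\pi'_{ij}=l_{ij}/L_i^{(k_{ij})}$. Clearing payments consistent with a strategy profile $\mathbf{s}=(s_1,\dots,s_n)$: a matrix $\mathbf{P}=(p_{ij})$ with $p_{ii}=0$, $0\le p_{ij}\le l_{ij}$ and, writing $p_i=\sum_j p_{ij}$, for every $i$: $p_i=L_i$ if $L_i\le e_i+\sum_j p_{ji}$ (solvent), and $p_i=\alpha e_i+\beta\sum_j p_{ji}$ otherwise (in default); moreover for every creditor $v_j$ of $v_i$, $$p_{ij}=\min\Big\{\max\Big\{\Big(p_i-\sum_{m=1}^{k_{ij}-1}L_i^{(m)}\Big)\pi'_{ij},\,0\Big\},\,l_{ij}\Big\},$$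 and $p_{ij}=0$ if $l_{ij}=0$. Clearing payments are proper if every firm with a positive outgoing payment is reachable, by a (possibly trivial) directed path of edges $(v_i,v_j)$ with $p_{ij}>0$, from some firm with positive external assets. Only proper clearing payments are considered. For every profile $\mathbf{s}$ there are maximal ones, denoted $\mathbf{P}(\mathbf{s})$, which are entrywise at least as large as all other proper clearing payments consistent with $\mathbf{s}$. Total assets: $a_i(\mathbf{P})=e_i+\sum_j p_{ji}$. The utility of $v_i$ under $\mathbf{s}$ is $a_i(\mathbf{P}(\mathbf{s}))$. A profile is a (pure) Nash equilibrium if no firm can strictly increase its utility by unilaterally changing its priority-proportional strategy. Social welfare: $SW(\mathbf{P})=\sum_i a_i(\mathbf{P})$; $OPT$ is the maximum of $SW(\mathbf{P}(\mathbf{s}))$ over all strategy profiles. The price of stability of an instance possessing at least one Nash equilibrium is the minimum of $OPT/SW(\mathbf{P}(\mathbf{s}))$ over Nash equilibria $\mathbf{s}$. *)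

theory Defs
  imports Complex_Main "HOL-Library.Disjoint_Sets" "HOL-Library.FuncSet"
begin

text \<open>Firms are the indices \<open>i < firms N\<close>. Values of the fields at other indices are never used.\<close>

record network =
  firms :: nat
  external :: "nat \<Rightarrow> real"
  liab :: "nat \<Rightarrow> nat \<Rightarrow> real"

definition financial_network :: "network \<Rightarrow> bool" where
  "financial_network N \<longleftrightarrow>
     (\<forall>i<firms N. external N i \<ge> 0) \<and>
     (\<forall>i<firms N. \<forall>j<firms N. liab N i j \<ge> 0) \<and>
     (\<forall>i<firms N. liab N i i = 0)"

definition total_liab :: "network \<Rightarrow> nat \<Rightarrow> real" where
  "total_liab N i = (\<Sum>j<firms N. liab N i j)"

definition creditors :: "network \<Rightarrow> nat \<Rightarrow> nat set" where
  "creditors N i = {j. j < firms N \<and> liab N i j > 0}"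

text \<open>A strategy is an ordered partition of the creditors, given as the list of its priority
  classes, highest priority first. List positions start at \<open>0\<close>, so the class at position \<open>m\<close>
  is the \<open>(m + 1)\<close>-st priority class.\<close>

type_synonym strategy = "nat set list"

definition strategies :: "network \<Rightarrow> nat \<Rightarrow> strategy set" where
  "strategies N i = {C. distinct C \<and> partition_on (creditors N i) (set C)}"

definition profiles :: "network \<Rightarrow> (nat \<Rightarrow> strategy) set" where
  "profiles N = (\<Pi>\<^sub>E i\<in>{..<firms N}. strategies N i)"

definition class_liab :: "network \<Rightarrow> (nat \<Rightarrow> strategy) \<Rightarrow> nat \<Rightarrow> nat \<Rightarrow> real" where
  "class_liab N s i m = (\<Sum>j\<in>s i ! m. liab N i j)"

definition class_index :: "(nat \<Rightarrow> strategy) \<Rightarrow> nat \<Rightarrow> nat \<Rightarrow> nat" where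
  "class_index s i j = (THE m. m < length (s i) \<and> j \<in> s i ! m)"

definition rel_liab :: "network \<Rightarrow> (nat \<Rightarrow> strategy) \<Rightarrow> nat \<Rightarrow> nat \<Rightarrow> real" where
  "rel_liab N s i j = liab N i j / class_liab N s i (class_index s i j)"

definition outgoing :: "network \<Rightarrow> (nat \<Rightarrow> nat \<Rightarrow> real) \<Rightarrow> nat \<Rightarrow> real" where
  "outgoing N P i = (\<Sum>j<firms N. P i j)"

definition incoming :: "network \<Rightarrow> (nat \<Rightarrow> nat \<Rightarrow> real) \<Rightarrow> nat \<Rightarrow> real" where
  "incoming N P i = (\<Sum>j<firms N. P j i)"

definition total_assets :: "network \<Rightarrow> (nat \<Rightarrow> nat \<Rightarrow> real) \<Rightarrow> nat \<Rightarrow> real" where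
  "total_assets N P i = external N i + incoming N P i"

text \<open>Entries of \<open>P\<close> outside the index range are required to be \<open>0\<close>, so that a payment matrix
  is determined by its entries inside the range.\<close>

definition clearing ::
  "real \<Rightarrow> real \<Rightarrow> network \<Rightarrow> (nat \<Rightarrow> strategy) \<Rightarrow> (nat \<Rightarrow> nat \<Rightarrow> real) \<Rightarrow> bool" where
  "clearing \<alpha> \<beta> N s P \<longleftrightarrow>
     (\<forall>i j. i \<ge> firms N \<or> j \<ge> firms N \<longrightarrow> P i j = 0) \<and>
     (\<forall>i<firms N. P i i = 0) \<and>
     (\<forall>i<firms N. \<forall>j<firms N. 0 \<le> P i j \<and> P i j \<le> liab N i j) \<and>
     (\<forall>i<firms N. outgoing N P i =
        (if total_liab N i \<le> total_assets N P i then total_liab N i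
         else \<alpha> * external N i + \<beta> * incoming N P i)) \<and>
     (\<forall>i<firms N. \<forall>j\<in>creditors N i. P i j =
        min (max ((outgoing N P i - (\<Sum>m<class_index s i j. class_liab N s i m))
                  * rel_liab N s i j) 0)
            (liab N i j)) \<and>
     (\<forall>i<firms N. \<forall>j<firms N. liab N i j = 0 \<longrightarrow> P i j = 0)"

definition payment_edges :: "network \<Rightarrow> (nat \<Rightarrow> nat \<Rightarrow> real) \<Rightarrow> (nat \<times> nat) set" where
  "payment_edges N P = {(i, j). i < firms N \<and> j < firms N \<and> P i j > 0}"

definition proper :: "network \<Rightarrow> (nat \<Rightarrow> nat \<Rightarrow> real) \<Rightarrow> bool" where
  "proper N P \<longleftrightarrow>
     (\<forall>i<firms N. (\<exists>j<firms N. P i j > 0) \<longrightarrow>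
        (\<exists>k<firms N. external N k > 0 \<and> (k, i) \<in> (payment_edges N P)\<^sup>*))"

definition maximal_clearing ::
  "real \<Rightarrow> real \<Rightarrow> network \<Rightarrow> (nat \<Rightarrow> strategy) \<Rightarrow> (nat \<Rightarrow> nat \<Rightarrow> real) \<Rightarrow> bool" where
  "maximal_clearing \<alpha> \<beta> N s P \<longleftrightarrow>
     clearing \<alpha> \<beta> N s P \<and> proper N P \<and>
     (\<forall>Q. clearing \<alpha> \<beta> N s Q \<and> proper N Q \<longrightarrow> (\<forall>i<firms N. \<forall>j<firms N. Q i j \<le> P i j))"

definition payments ::
  "real \<Rightarrow> real \<Rightarrow> network \<Rightarrow> (nat \<Rightarrow> strategy) \<Rightarrow> nat \<Rightarrow> nat \<Rightarrow> real" where
  "payments \<alpha> \<beta> N s = (THE P. maximal_clearing \<alpha> \<beta> N s P)"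

definition utility ::
  "real \<Rightarrow> real \<Rightarrow> network \<Rightarrow> (nat \<Rightarrow> strategy) \<Rightarrow> nat \<Rightarrow> real" where
  "utility \<alpha> \<beta> N s i = total_assets N (payments \<alpha> \<beta> N s) i"

definition nash_equilibria ::
  "real \<Rightarrow> real \<Rightarrow> network \<Rightarrow> (nat \<Rightarrow> strategy) set" where
  "nash_equilibria \<alpha> \<beta> N =
     {s \<in> profiles N. \<forall>i<firms N. \<forall>t\<in>strategies N i.
        \<not> utility \<alpha> \<beta> N (s(i := t)) i > utility \<alpha> \<beta> N s i}"

definition social_welfare :: "network \<Rightarrow> (nat \<Rightarrow> nat \<Rightarrow> real) \<Rightarrow> real" where
  "social_welfare N P = (\<Sum>i<firms N. total_assets N P i)"

definition opt_welfare :: "real \<Rightarrow> real \<Rightarrow> network \<Rightarrow> real" where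
  "opt_welfare \<alpha> \<beta> N = Max ((\<lambda>s. social_welfare N (payments \<alpha> \<beta> N s)) ` profiles N)"

text \<open>Meaningful only if there is a Nash equilibrium. Social welfare vanishes only if all external
  assets do; then every proper payment vanishes and the quotient below is \<open>0 / 0 = 0\<close>.\<close>

definition price_of_stability :: "real \<Rightarrow> real \<Rightarrow> network \<Rightarrow> real" where
  "price_of_stability \<alpha> \<beta> N =
     Min ((\<lambda>s. opt_welfare \<alpha> \<beta> N / social_welfare N (payments \<alpha> \<beta> N s))
          ` nash_equilibria \<alpha> \<beta> N)"

end

theory Submission
  imports Defs
begin

text \<open>
  Firms 2 and 3 owe each other a huge amount \<open>M\<close> and have no external assets, so properness
  keeps them idle unless firm 0 pays something to firm 2; any positive payment, however small,
  makes the whole cycle clear. Firm 0, which always defaults, prefers to pay firm 1: firm 1 owes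
  firm 0 exactly \<open>\<alpha> + \<beta>\<close> and can pay it in full only if firm 0 serves firm 1 strictly before
  firm 2. This determines the equilibrium, and its welfare is bounded independently of \<open>M\<close>.
  The solvent firm 4 only feeds firm 0, so that firm 0 has a positive payment to make even if
  \<open>\<alpha> = 0\<close> (and firm 0's own external assets serve the case \<open>\<beta> = 0\<close>).
\<close>

section \<open>Ordered partitions of sets with one or two elements\<close>

lemma partition_on_doubleton:
  assumes "a \<noteq> b" and "partition_on {a, b} Q"
  shows "Q = {{a, b}} \<or> Q = {{a}, {b}}"
proof -
  have U: "\<Union>Q = {a, b}" and D: "disjoint Q" and E: "{} \<notin> Q"
    using assms(2) by (auto simp: partition_on_def)
  have sub: "Q \<subseteq> {{a}, {b}, {a, b}}"
  proof
    fix X assume "X \<in> Q"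
    then have "X \<subseteq> {a, b}" "X \<noteq> {}" using U E by auto
    then show "X \<in> {{a}, {b}, {a, b}}" by blast
  qed
  show ?thesis
  \<comment> \<open>The full set, if it is a class, excludes both singletons by disjointness;
    otherwise both singletons are needed to cover \<open>a\<close> and \<open>b\<close>.\<close>
  proof (cases "{a, b} \<in> Q")
    case True
    then have "{a} \<notin> Q" "{b} \<notin> Q"
      using disjointD[OF D, of "{a, b}"] assms(1) by auto
    with True sub show ?thesis by auto
  next
    case False
    with sub have "Q \<subseteq> {{a}, {b}}" by blast
    moreover have "{a} \<in> Q" "{b} \<in> Q" using U calculation assms(1) by auto
    ultimately show ?thesis by blast
  qed
qed

lemma distinct_set_eq_singleton_iff: "distinct C \<and> set C = {X} \<longleftrightarrow> C = [X]"
proof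
  assume "distinct C \<and> set C = {X}"
  then have "length C = 1" "set C = {X}" using distinct_card[of C] by auto
  then show "C = [X]" by (cases C) auto
qed auto

lemma distinct_set_eq_doubleton:
  assumes "distinct C" and "set C = {X, Y}" and "X \<noteq> Y"
  shows "C = [X, Y] \<or> C = [Y, X]"
proof -
  have "length C = 2" using assms distinct_card[of C] by auto
  then obtain u v where "C = [u, v]" by (auto simp: length_Suc_conv numeral_2_eq_2)
  then show ?thesis using assms by (auto simp: doubleton_eq_iff)
qed

lemma strategies_singleton:
  assumes "creditors N i = {j}"
  shows "strategies N i = {[{j}]}"
proof -
  have "partition_on {j} Q \<longleftrightarrow> Q = {{j}}" for Q :: "nat set set"
  proof
    assume Q: "partition_on {j} Q"
    then have "X = {j}" if "X \<in> Q" for X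
      using that by (metis Sup_upper partition_onD1 partition_onD3 subset_singletonD)
    moreover have "Q \<noteq> {}" using Q by (auto simp: partition_on_def)
    ultimately show "Q = {{j}}" by blast
  qed (simp add: partition_on_def)
  then show ?thesis
    by (simp add: strategies_def assms distinct_set_eq_singleton_iff)
qed

lemma strategies_doubleton:
  assumes "creditors N i = {j, k}" and "j \<noteq> k"
  shows "strategies N i = {[{j}, {k}], [{k}, {j}], [{j, k}]}"
proof -
  have "partition_on {j, k} {{j, k}}" "partition_on {j, k} {{j}, {k}}"
    using assms(2) by (auto simp: partition_on_def disjoint_def)
  moreover have "C \<in> {[{j}, {k}], [{k}, {j}], [{j, k}]}"
    if "distinct C" and part: "partition_on {j, k} (set C)" for C
  proof -
    consider "set C = {{j, k}}" | "set C = {{j}, {k}}"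
      using partition_on_doubleton[OF assms(2) part] by metis
    then show ?thesis
    proof cases
      case 1
      with \<open>distinct C\<close> have "C = [{j, k}]" by (simp flip: distinct_set_eq_singleton_iff)
      then show ?thesis by simp
    next
      case 2
      then show ?thesis using distinct_set_eq_doubleton[OF \<open>distinct C\<close> 2] assms(2) by auto
    qed
  qed
  ultimately show ?thesis
    unfolding strategies_def assms(1) using assms(2) by (auto simp: insert_commute)
qed

section \<open>Resolving the two definite descriptions: class indices and payments\<close>

lemma class_index_eq:
  assumes "s i \<in> strategies N i" and "m < length (s i)" and "j \<in> s i ! m"
  shows "class_index s i j = m"
  unfolding class_index_def
proof (rule the_equality)
  fix n assume n: "n < length (s i) \<and> j \<in> s i ! n"
  have "disjoint (set (s i))" "distinct (s i)"
    using assms(1) by (auto simp: strategies_def partition_on_def)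
  then show "n = m"
    using n assms(2,3) by (metis disjointD disjoint_iff nth_eq_iff_index_eq nth_mem)
qed (use assms in auto)

text \<open>Two maximal matrices bound each other entrywise inside the index range, and both vanish
  outside it by the convention in \<open>clearing\<close>. Hence exhibiting one maximal matrix
  computes \<open>payments\<close>, with no general existence theorem.\<close>

lemma payments_eq_maximal_clearing:
  assumes P: "maximal_clearing \<alpha> \<beta> N s P"
  shows "payments \<alpha> \<beta> N s = P"
  unfolding payments_def
proof (rule the_equality)
  fix Q assume Q: "maximal_clearing \<alpha> \<beta> N s Q"
  show "Q = P"
  proof (intro ext)
    fix i j
    show "Q i j = P i j"
    proof (cases "i < firms N \<and> j < firms N")
      case True
      have "clearing \<alpha> \<beta> N s P" "proper N P" "clearing \<alpha> \<beta> N s Q" "proper N Q"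
        using P Q by (auto simp: maximal_clearing_def)
      with True show ?thesis
        using P Q unfolding maximal_clearing_def by (intro order_antisym) blast+
    next
      case False
      then have zero: "R i j = 0" if "maximal_clearing \<alpha> \<beta> N s R" for R
        using that unfolding maximal_clearing_def clearing_def by (meson not_less)
      show ?thesis using zero[OF P] zero[OF Q] by simp
    qed
  qed
qed (rule P)

lemma lessThan_5: "{..<5::nat} = {0, 1, 2, 3, 4}" by auto

section \<open>The network and its strategy profiles\<close>

locale detached_cycle =
  fixes \<alpha> \<beta> M :: real
  assumes \<alpha>: "0 \<le> \<alpha>" "\<alpha> \<le> 1" and \<beta>: "0 \<le> \<beta>" "\<beta> \<le> 1"
    and pos: "0 < \<alpha> + \<beta>" and M: "0 < M"
begin

text \<open>The 4 is an upper bound for everything firm 0 can pay, so firm 1 absorbs it all when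
  served first. The 8 gives firm 1 only a third in a tie, too little for solvency; with an even
  split firm 1 could be solvent when \<beta> = 1.\<close>

definition liabilities :: "nat \<Rightarrow> nat \<Rightarrow> real" where
  "liabilities i j =
     (if i = 0 \<and> j = 1 then 4 else if i = 0 \<and> j = 2 then 8
      else if i = 1 \<and> j = 0 then \<alpha> + \<beta>
      else if i = 2 \<and> j = 3 \<or> i = 3 \<and> j = 2 then M
      else if i = 4 \<and> j = 0 then 1 else 0)"

definition net :: network where
  "net = \<lparr>firms = 5, external = (\<lambda>i. if i = 0 \<or> i = 4 then 1 else 0), liab = liabilities\<rparr>"

text \<open>One argument per edge of the network. By \<open>clearing_imp_pay\<close> every clearing
  matrix has this form, so clearing and maximality become statements about six real numbers.\<close>

definition pay :: "real \<Rightarrow> real \<Rightarrow> real \<Rightarrow> real \<Rightarrow> real \<Rightarrow> real \<Rightarrow> nat \<Rightarrow> nat \<Rightarrow> real" where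
  "pay a b c d e f i j =
     (if i = 0 \<and> j = 1 then a else if i = 0 \<and> j = 2 then b
      else if i = 1 \<and> j = 0 then c
      else if i = 2 \<and> j = 3 then d else if i = 3 \<and> j = 2 then e
      else if i = 4 \<and> j = 0 then f else 0)"

text \<open>Only firm 0 has more than one creditor, so its strategy determines the profile. The
  value \<open>undefined\<close> elsewhere is what the extensional function space in
  \<open>profiles\<close> demands.\<close>

definition profile :: "strategy \<Rightarrow> nat \<Rightarrow> strategy" where
  "profile t = (\<lambda>i. undefined)(0 := t, 1 := [{0}], 2 := [{3}], 3 := [{2}], 4 := [{0}])"

declare One_nat_def [simp del]

lemma net_sel [simp]:
  "firms net = 5" "external net i = (if i = 0 \<or> i = 4 then 1 else 0)" "liab net = liabilities"
  by (simp_all add: net_def)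

lemma less_5_iff: "i < (5::nat) \<longleftrightarrow> i = 0 \<or> i = 1 \<or> i = 2 \<or> i = 3 \<or> i = 4" by auto

lemma all_less_5: "(\<forall>i<5::nat. Q i) \<longleftrightarrow> Q 0 \<and> Q 1 \<and> Q 2 \<and> Q 3 \<and> Q 4"
  by (auto simp: less_5_iff)

lemma financial_network_net: "financial_network net"
  using \<alpha> \<beta> M by (auto simp: financial_network_def liabilities_def)

lemma creditors_net:
  "creditors net 0 = {1, 2}" "creditors net 1 = {0}" "creditors net 2 = {3}"
  "creditors net 3 = {2}" "creditors net 4 = {0}"
  using pos M by (auto simp: creditors_def liabilities_def split: if_splits)

lemma strategies_net_0: "strategies net 0 = {[{1}, {2}], [{2}, {1}], [{1, 2}]}"
  by (rule strategies_doubleton) (simp_all add: creditors_net)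

lemma strategies_net:
  "strategies net 1 = {[{0}]}" "strategies net 2 = {[{3}]}"
  "strategies net 3 = {[{2}]}" "strategies net 4 = {[{0}]}"
  by (simp_all only: strategies_singleton creditors_net)

lemma profile_in: "t \<in> strategies net 0 \<Longrightarrow> i < 5 \<Longrightarrow> profile t i \<in> strategies net i"
  using strategies_net unfolding less_5_iff by (auto simp: profile_def)

lemma profiles_net: "profiles net = profile ` strategies net 0"
proof (intro set_eqI iffI)
  fix s assume "s \<in> profiles net"
  then have s: "s i \<in> strategies net i" if "i < 5" for i
    using that by (auto simp: profiles_def PiE_iff)
  have u: "s i = undefined" if "\<not> i < 5" for i
    using \<open>s \<in> profiles net\<close> that by (auto simp: profiles_def PiE_iff extensional_def)
  have "s = profile (s 0)"
  proof
    fix i show "s i = profile (s 0) i"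
      using s[of 1] s[of 2] s[of 3] s[of 4] u[of i] strategies_net
      by (cases "i < 5") (auto simp: profile_def less_5_iff)
  qed
  then show "s \<in> profile ` strategies net 0" using s[of 0] by auto
next
  fix s assume "s \<in> profile ` strategies net 0"
  then show "s \<in> profiles net"
    using profile_in by (auto simp: profiles_def PiE_iff extensional_def profile_def)
qed

lemma class_index_profile:
  assumes "t \<in> strategies net 0"
  shows "class_index (profile t) 1 0 = 0" "class_index (profile t) 2 3 = 0"
    "class_index (profile t) 3 2 = 0" "class_index (profile t) 4 0 = 0"
    "m < length t \<Longrightarrow> j \<in> t ! m \<Longrightarrow> class_index (profile t) 0 j = m"
proof -
  have *: "class_index (profile t) i j = m"
    if "i < 5" "m < length (profile t i)" "j \<in> profile t i ! m" for i j m
    using that by (intro class_index_eq[of _ _ net] profile_in[OF assms])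
  show "class_index (profile t) 1 0 = 0" "class_index (profile t) 2 3 = 0"
    "class_index (profile t) 3 2 = 0" "class_index (profile t) 4 0 = 0"
    by (rule *; simp add: profile_def)+
  show "class_index (profile t) 0 j = m" if "m < length t" "j \<in> t ! m"
    by (rule *) (use that in \<open>simp_all add: profile_def\<close>)
qed

section \<open>Clearing as a system of equations in six payments\<close>

lemma clearing_imp_pay:
  assumes "clearing \<alpha> \<beta> net s P"
  shows "P = pay (P 0 1) (P 0 2) (P 1 0) (P 2 3) (P 3 2) (P 4 0)"
proof (intro ext)
  fix i j
  show "P i j = pay (P 0 1) (P 0 2) (P 1 0) (P 2 3) (P 3 2) (P 4 0) i j"
  proof (cases "(i, j) \<in> {(0, 1), (0, 2), (1, 0), (2, 3), (3, 2), (4, 0)}")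
    case True
    then show ?thesis by (auto simp: pay_def)
  next
    case False
    then have "liabilities i j = 0" by (auto simp: liabilities_def)
    moreover have "P i j = 0" if "\<not> (i < 5 \<and> j < 5)"
      using assms that unfolding clearing_def by (auto simp: not_less)
    ultimately have "P i j = 0"
      using assms unfolding clearing_def net_sel by metis
    with False show ?thesis by (auto simp: pay_def)
  qed
qed

lemma clearing_pay_iff:
  assumes t: "t \<in> strategies net 0"
  shows "clearing \<alpha> \<beta> net (profile t) (pay a b c d e f) \<longleftrightarrow>
     0 \<le> a \<and> a \<le> 4 \<and> 0 \<le> b \<and> b \<le> 8 \<and> 0 \<le> c \<and> c \<le> \<alpha> + \<beta> \<and> 0 \<le> d \<and> d \<le> M \<and>
     0 \<le> e \<and> e \<le> M \<and> f = 1 \<and> a + b = \<alpha> + \<beta> + \<beta> * c \<and>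
     c = (if \<alpha> + \<beta> \<le> a then \<alpha> + \<beta> else \<beta> * a) \<and>
     d = (if M \<le> b + e then M else \<beta> * (b + e)) \<and> e = (if M \<le> d then M else \<beta> * d) \<and>
     (t = [{1}, {2}] \<longrightarrow> a = min (a + b) 4) \<and> (t = [{2}, {1}] \<longrightarrow> b = min (a + b) 8) \<and>
     (t = [{1, 2}] \<longrightarrow> b = 2 * a)" (is "?L \<longleftrightarrow> ?R")
proof -
  let ?s = "profile t"
  have rel: "rel_liab net ?s 1 0 = 1" "rel_liab net ?s 2 3 = 1" "rel_liab net ?s 3 2 = 1"
    "rel_liab net ?s 4 0 = 1"
    using class_index_profile[OF t] pos M
    by (simp_all add: rel_liab_def class_liab_def profile_def liabilities_def)
  have out: "outgoing net (pay a b c d e f) 0 = a + b" "outgoing net (pay a b c d e f) 1 = c"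
    "outgoing net (pay a b c d e f) 2 = d" "outgoing net (pay a b c d e f) 3 = e"
    "outgoing net (pay a b c d e f) 4 = f"
    by (simp_all add: outgoing_def lessThan_5 pay_def)
  have inc: "incoming net (pay a b c d e f) 0 = c + f" "incoming net (pay a b c d e f) 1 = a"
    "incoming net (pay a b c d e f) 2 = b + e" "incoming net (pay a b c d e f) 3 = d"
    "incoming net (pay a b c d e f) 4 = 0"
    by (simp_all add: incoming_def lessThan_5 pay_def)
  have tot: "total_liab net 0 = 12" "total_liab net 1 = \<alpha> + \<beta>" "total_liab net 2 = M"
    "total_liab net 3 = M" "total_liab net 4 = 1"
    by (simp_all add: total_liab_def lessThan_5 liabilities_def)
  have bds: "(\<forall>i<firms net. \<forall>j<firms net. 0 \<le> pay a b c d e f i j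
      \<and> pay a b c d e f i j \<le> liab net i j) \<longleftrightarrow>
     0 \<le> a \<and> a \<le> 4 \<and> 0 \<le> b \<and> b \<le> 8 \<and> 0 \<le> c \<and> c \<le> \<alpha> + \<beta> \<and> 0 \<le> d \<and> d \<le> M \<and>
     0 \<le> e \<and> e \<le> M \<and> 0 \<le> f \<and> f \<le> 1"
    unfolding net_sel all_less_5 by (simp add: pay_def liabilities_def)
  have zero: "(\<forall>i j. i \<ge> firms net \<or> j \<ge> firms net \<longrightarrow> pay a b c d e f i j = 0) \<and>
     (\<forall>i<firms net. pay a b c d e f i i = 0) \<and>
     (\<forall>i<firms net. \<forall>j<firms net. liab net i j = 0 \<longrightarrow> pay a b c d e f i j = 0)"
    using pos M by (auto simp: pay_def liabilities_def)
  \<comment> \<open>Firm 4 can just pay its debt, so \<open>f = 1\<close>. The bound on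
    \<open>c\<close> then keeps the assets of firm 0 at or below 4, less than its liability 12, so
    its default branch is the only one.\<close>
  have flow: "(\<forall>i<firms net. outgoing net (pay a b c d e f) i =
        (if total_liab net i \<le> total_assets net (pay a b c d e f) i then total_liab net i
         else \<alpha> * external net i + \<beta> * incoming net (pay a b c d e f) i)) \<longleftrightarrow>
     f = 1 \<and> a + b = \<alpha> + \<beta> + \<beta> * c \<and>
     c = (if \<alpha> + \<beta> \<le> a then \<alpha> + \<beta> else \<beta> * a) \<and>
     d = (if M \<le> b + e then M else \<beta> * (b + e)) \<and> e = (if M \<le> d then M else \<beta> * d)"
    if "c \<le> \<alpha> + \<beta>"
    unfolding net_sel all_less_5 total_assets_def out inc tot
    using that \<alpha> \<beta> by (auto simp: algebra_simps)
  \<comment> \<open>For a firm with a single creditor the priority rule follows from the bounds. For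
    firm 0 one equation per strategy suffices, since the other payment is the remainder of
    \<open>a + b\<close>.\<close>
  have split: "(\<forall>i<firms net. \<forall>j\<in>creditors net i. pay a b c d e f i j =
        min (max ((outgoing net (pay a b c d e f) i
            - (\<Sum>m<class_index ?s i j. class_liab net ?s i m)) * rel_liab net ?s i j) 0)
          (liab net i j)) \<longleftrightarrow>
     (t = [{1}, {2}] \<longrightarrow> a = min (a + b) 4) \<and> (t = [{2}, {1}] \<longrightarrow> b = min (a + b) 8) \<and>
     (t = [{1, 2}] \<longrightarrow> b = 2 * a)"
    if "0 \<le> a" "a \<le> 4" "0 \<le> b" "b \<le> 8" "0 \<le> c" "c \<le> \<alpha> + \<beta>" "0 \<le> d" "d \<le> M" "0 \<le> e"
      "e \<le> M" "0 \<le> f" "f \<le> 1"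
  proof -
    note * = class_index_profile[OF t] and ** = class_index_profile(5)[OF t, of 0]
      class_index_profile(5)[OF t, of "Suc 0"]
    consider "t = [{1}, {2}]" | "t = [{2}, {1}]" | "t = [{1, 2}]"
      using t strategies_net_0 by auto
    then show ?thesis
    proof cases
      case 1
      show ?thesis
        unfolding net_sel all_less_5 creditors_net out
        using that *(1-4) rel **(1)[of 1] **(2)[of 2] 1
        by (auto simp: pay_def liabilities_def rel_liab_def class_liab_def profile_def min_def max_def)
    next
      case 2
      show ?thesis
        unfolding net_sel all_less_5 creditors_net out
        using that *(1-4) rel **(1)[of 2] **(2)[of 1] 2
        by (auto simp: pay_def liabilities_def rel_liab_def class_liab_def profile_def min_def max_def)
    next
      case 3
      show ?thesis
        unfolding net_sel all_less_5 creditors_net out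
        using that *(1-4) rel **(1)[of 1] **(1)[of 2] 3
        by (auto simp: pay_def liabilities_def rel_liab_def class_liab_def profile_def min_def max_def)
    qed
  qed
  show ?thesis
  \<comment> \<open>Both sides entail these bounds, the right one using \<open>f = 1\<close>; so
    outside them both fail, and inside them \<open>flow\<close> and \<open>split\<close>
    apply.\<close>
  proof (cases "0 \<le> a \<and> a \<le> 4 \<and> 0 \<le> b \<and> b \<le> 8 \<and> 0 \<le> c \<and> c \<le> \<alpha> + \<beta> \<and> 0 \<le> d
      \<and> d \<le> M \<and> 0 \<le> e \<and> e \<le> M \<and> 0 \<le> f \<and> f \<le> 1")
    case True
    then have flow': "c \<le> \<alpha> + \<beta>" and bounds: "0 \<le> a" "a \<le> 4" "0 \<le> b" "b \<le> 8" "0 \<le> c"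
      "c \<le> \<alpha> + \<beta>" "0 \<le> d" "d \<le> M" "0 \<le> e" "e \<le> M" "0 \<le> f" "f \<le> 1"
      by blast+
    show ?thesis
      unfolding clearing_def bds flow[OF flow'] split[OF bounds] using zero True by argo
  next
    case False
    then show ?thesis
      unfolding clearing_def bds by argo
  qed
qed

section \<open>Properness and the detached cycle\<close>

lemma proper_pay_detached:
  assumes "proper net (pay a 0 c d e f)" and "0 \<le> d" "0 \<le> e"
  shows "d = 0" "e = 0"
proof -
  \<comment> \<open>Tracing a path backwards: with \<open>b = 0\<close> no payment enters firms 2
    and 3 from outside, and neither has external assets to start from.\<close>
  have closed: "k \<in> {2, 3}"
    if "(k, i) \<in> (payment_edges net (pay a 0 c d e f))\<^sup>*" "i \<in> {2, 3}" for k i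
    using that
    by (induction rule: converse_rtrancl_induct)
      (auto simp: payment_edges_def pay_def split: if_splits)
  have "\<not> pay a 0 c d e f i j > 0" if "i \<in> {2, 3}" "j < 5" for i j
  proof
    assume "pay a 0 c d e f i j > 0"
    moreover have "i < 5" using that by auto
    ultimately obtain k
      where "external net k > 0" "(k, i) \<in> (payment_edges net (pay a 0 c d e f))\<^sup>*"
      using assms(1) \<open>j < 5\<close> unfolding proper_def net_sel(1) by meson
    with closed[OF this(2) \<open>i \<in> {2, 3}\<close>] show False by auto
  qed
  from this[of 2 3] this[of 3 2] have "\<not> d > 0" "\<not> e > 0" by (auto simp: pay_def less_5_iff)
  then show "d = 0" "e = 0" using assms by auto
qed

text \<open>Firms 0 and 4 are their own sources; the conditions supply a path from firm 0 to every
  other payer.\<close>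

lemma proper_pay:
  assumes "d = 0 \<and> e = 0 \<or> b > 0 \<and> d > 0" and "c = 0 \<or> a > 0"
  shows "proper net (pay a b c d e f)"
proof -
  let ?E = "payment_edges net (pay a b c d e f)"
  have edges: "a > 0 \<Longrightarrow> (0, 1) \<in> ?E" "b > 0 \<Longrightarrow> (0, 2) \<in> ?E" "d > 0 \<Longrightarrow> (2, 3) \<in> ?E"
    by (simp_all add: payment_edges_def pay_def)
  have "\<exists>k<5. external net k > 0 \<and> (k, i) \<in> ?E\<^sup>*" if "i < 5" and payer: "pay a b c d e f i j > 0" for i j
  proof -
    consider "i = 0 \<or> i = 4" | "i = 1" "a > 0" | "i = 2" "b > 0" | "i = 3" "b > 0" "d > 0"
      using payer assms unfolding pay_def by (cases "i = 0 \<or> i = 4") (auto split: if_splits)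
    then show ?thesis
    proof cases
      case 1
      then show ?thesis by (intro exI[of _ i]) auto
    next
      case 4
      then have "(0, i) \<in> ?E\<^sup>*" using edges(2,3) by (meson rtrancl.simps)
      then show ?thesis by (intro exI[of _ 0]) simp
    qed (use edges in \<open>intro exI[of _ 0]; auto\<close>)+
  qed
  then show ?thesis unfolding proper_def net_sel(1) by blast
qed

section \<open>Maximal payments under each of the three strategies of firm 0\<close>

lemma maximal_clearing_payI:
  assumes t: "t \<in> strategies net 0"
    and "clearing \<alpha> \<beta> net (profile t) (pay a b c d e f)" and "proper net (pay a b c d e f)"
    and le: "\<And>a' b' c' d' e' f'. clearing \<alpha> \<beta> net (profile t) (pay a' b' c' d' e' f') \<Longrightarrow>
      proper net (pay a' b' c' d' e' f') \<Longrightarrow>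
      a' \<le> a \<and> b' \<le> b \<and> c' \<le> c \<and> d' \<le> d \<and> e' \<le> e \<and> f' \<le> f"
  shows "maximal_clearing \<alpha> \<beta> net (profile t) (pay a b c d e f)"
  unfolding maximal_clearing_def
proof (intro conjI allI impI)
  fix Q i j assume "clearing \<alpha> \<beta> net (profile t) Q \<and> proper net Q"
  then obtain a' b' c' d' e' f' where Q: "Q = pay a' b' c' d' e' f'"
    "clearing \<alpha> \<beta> net (profile t) Q" "proper net Q"
    using clearing_imp_pay by blast
  from le[OF Q(2,3)[unfolded Q(1)]] show "Q i j \<le> pay a b c d e f i j"
    by (simp add: Q(1) pay_def)
qed (use assms in auto)

text \<open>The first two bounds keep the payment \<open>\<alpha> + \<beta> + \<beta> * c\<close> of
  firm 0 at or below 4 whenever \<open>c \<le> \<alpha> + \<beta>\<close>.\<close>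

lemma \<beta>_bounds: "\<beta> * (\<alpha> + \<beta>) \<le> 2" "\<alpha> + \<beta> \<le> 2" "0 \<le> \<beta> * (\<alpha> + \<beta>)"
  using \<alpha> \<beta> mult_left_le_one_le[of "\<alpha> + \<beta>" \<beta>] by auto

text \<open>Firm 1 receives at least \<alpha> + \<beta>, so it is solvent and returns its full debt.
  Nothing is left over for firm 2.\<close>

lemma payments_firm1_first:
  "payments \<alpha> \<beta> net (profile [{1}, {2}]) =
     pay (\<alpha> + \<beta> + \<beta> * (\<alpha> + \<beta>)) 0 (\<alpha> + \<beta>) 0 0 1"
proof (rule payments_eq_maximal_clearing, rule maximal_clearing_payI)
  show t: "[{1}, {2}] \<in> strategies net 0" by (simp add: strategies_net_0)
  show "clearing \<alpha> \<beta> net (profile [{1}, {2}])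
      (pay (\<alpha> + \<beta> + \<beta> * (\<alpha> + \<beta>)) 0 (\<alpha> + \<beta>) 0 0 1)"
    using \<beta>_bounds pos M by (simp add: clearing_pay_iff[OF t])
  show "proper net (pay (\<alpha> + \<beta> + \<beta> * (\<alpha> + \<beta>)) 0 (\<alpha> + \<beta>) 0 0 1)"
    using \<beta>_bounds pos by (intro proper_pay) auto
  fix a b c d e f
  assume "clearing \<alpha> \<beta> net (profile [{1}, {2}]) (pay a b c d e f)"
    and proper: "proper net (pay a b c d e f)"
  then have *: "0 \<le> b" "0 \<le> c" "c \<le> \<alpha> + \<beta>" "0 \<le> d" "0 \<le> e" "f = 1"
    "a + b = \<alpha> + \<beta> + \<beta> * c" "a = min (a + b) 4"
    unfolding clearing_pay_iff[OF t] by blast+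
  have "\<beta> * c \<le> \<beta> * (\<alpha> + \<beta>)" using * \<beta> by (intro mult_left_mono)
  then have "a + b \<le> 4" and a: "a + b \<le> \<alpha> + \<beta> + \<beta> * (\<alpha> + \<beta>)" using * \<beta>_bounds by linarith+
  then have b: "b = 0" using *(8) by simp
  \<comment> \<open>Here properness is decisive: \<open>d = e = M\<close> would satisfy the clearing
    equations even with \<open>b = 0\<close>, since the cycle supports itself.\<close>
  have "d = 0" "e = 0" using proper_pay_detached proper *(4,5) unfolding b by blast+
  then show "a \<le> \<alpha> + \<beta> + \<beta> * (\<alpha> + \<beta>) \<and> b \<le> 0 \<and> c \<le> \<alpha> + \<beta> \<and> d \<le> 0 \<and> e \<le> 0 \<and> f \<le> 1"
    using * a b by simp
qed

text \<open>Firm 0 pays at most 4, less than the 8 owed to firm 2, so firm 1 receives and returns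
  nothing. The positive payment to firm 2 makes the full cycle proper.\<close>

lemma payments_firm2_first:
  "payments \<alpha> \<beta> net (profile [{2}, {1}]) = pay 0 (\<alpha> + \<beta>) 0 M M 1"
proof (rule payments_eq_maximal_clearing, rule maximal_clearing_payI)
  show t: "[{2}, {1}] \<in> strategies net 0" by (simp add: strategies_net_0)
  show "clearing \<alpha> \<beta> net (profile [{2}, {1}]) (pay 0 (\<alpha> + \<beta>) 0 M M 1)"
    using \<beta>_bounds pos M by (simp add: clearing_pay_iff[OF t])
  show "proper net (pay 0 (\<alpha> + \<beta>) 0 M M 1)"
    using pos M by (intro proper_pay) auto
  fix a b c d e f
  assume "clearing \<alpha> \<beta> net (profile [{2}, {1}]) (pay a b c d e f)"
  then have *: "0 \<le> a" "c \<le> \<alpha> + \<beta>" "d \<le> M" "e \<le> M" "f = 1" "a + b = \<alpha> + \<beta> + \<beta> * c"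
     "b = min (a + b) 8" "c = (if \<alpha> + \<beta> \<le> a then \<alpha> + \<beta> else \<beta> * a)"
    unfolding clearing_pay_iff[OF t] by blast+
  have "\<beta> * c \<le> \<beta> * (\<alpha> + \<beta>)" using * \<beta> by (intro mult_left_mono)
  then have "a + b \<le> 8" using * \<beta>_bounds by linarith
  then have "a = 0" using *(7) by simp
  then show "a \<le> 0 \<and> b \<le> \<alpha> + \<beta> \<and> c \<le> 0 \<and> d \<le> M \<and> e \<le> M \<and> f \<le> 1"
    using * pos by simp
qed

text \<open>Firm 1 gets a third of what firm 0 pays, which is less than \<alpha> + \<beta>, so it
  defaults. For the equilibrium analysis only the strict bound on its repayment \<open>c\<close>
  matters.\<close>

lemma payments_tie:
  obtains a b c where "payments \<alpha> \<beta> net (profile [{1, 2}]) = pay a b c M M 1" "c < \<alpha> + \<beta>"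
proof -
  \<comment> \<open>The solution of \<open>3 * a = \<alpha> + \<beta> + \<beta> * c\<close> with the
    default repayment \<open>c = \<beta> * a\<close>.\<close>
  define a where "a = (\<alpha> + \<beta>) / (3 - \<beta> * \<beta>)"
  have \<beta>\<beta>: "\<beta> * \<beta> \<le> 1" using \<beta> by (intro mult_le_one)
  have a: "0 < a" "3 * a = \<alpha> + \<beta> + \<beta> * (\<beta> * a)"
    using \<beta>\<beta> pos by (auto simp: a_def field_simps)
  have \<beta>a: "\<beta> * a \<le> a" "0 \<le> \<beta> * a" "\<beta> * (\<beta> * a) \<le> \<beta> * a"
    using \<beta> a by (auto intro: mult_left_le_one_le)
  have a_less: "a < \<alpha> + \<beta>" using a \<beta>a pos by linarith
  have le: "a \<le> 2" "\<beta> * a \<le> \<alpha> + \<beta>" using a_less \<beta>a(1) \<beta>_bounds(2) by linarith+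
  have t: "[{1, 2}] \<in> strategies net 0" by (simp add: strategies_net_0)
  have "maximal_clearing \<alpha> \<beta> net (profile [{1, 2}]) (pay a (2 * a) (\<beta> * a) M M 1)"
  proof (rule maximal_clearing_payI[OF t])
    show "clearing \<alpha> \<beta> net (profile [{1, 2}]) (pay a (2 * a) (\<beta> * a) M M 1)"
      unfolding clearing_pay_iff[OF t] using a M a_less \<beta>a(2) le by (intro conjI impI) auto
    show "proper net (pay a (2 * a) (\<beta> * a) M M 1)"
      using a M by (intro proper_pay) auto
    fix a' b c d e f
    assume "clearing \<alpha> \<beta> net (profile [{1, 2}]) (pay a' b c d e f)"
    then have *: "0 \<le> c" "c \<le> \<alpha> + \<beta>" "d \<le> M" "e \<le> M" "f = 1" "a' + b = \<alpha> + \<beta> + \<beta> * c"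
      "b = 2 * a'" "c = (if \<alpha> + \<beta> \<le> a' then \<alpha> + \<beta> else \<beta> * a')"
      unfolding clearing_pay_iff[OF t] by blast+
    \<comment> \<open>This rules out solvency of firm 1 in any competitor: \<open>3 * a' \<le>
      \<alpha> + \<beta> + c \<le> 2 * (\<alpha> + \<beta>)\<close>. The remaining linear equation
      has \<open>a\<close> as its only solution.\<close>
    have "\<beta> * c \<le> c" using * \<beta> by (intro mult_left_le_one_le)
    then have "a' < \<alpha> + \<beta>" using * pos by linarith
    then have c: "c = \<beta> * a'" using * by simp
    then have "a' * (3 - \<beta> * \<beta>) = \<alpha> + \<beta>" using * by (simp add: algebra_simps)
    then have "a' = a" using \<beta>\<beta> by (simp add: a_def field_simps)
    then show "a' \<le> a \<and> b \<le> 2 * a \<and> c \<le> \<beta> * a \<and> d \<le> M \<and> e \<le> M \<and> f \<le> 1"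
      using * c by simp
  qed
  then show ?thesis
    using that payments_eq_maximal_clearing a_less \<beta>a by (metis order_le_less_trans)
qed

section \<open>The unique equilibrium and its welfare\<close>

lemma total_assets_pay_0: "total_assets net (pay a b c d e f) 0 = 1 + c + f"
  by (simp add: total_assets_def incoming_def lessThan_5 pay_def)

lemma social_welfare_pay: "social_welfare net (pay a b c d e f) = 2 + a + b + c + d + e + f"
  by (simp add: social_welfare_def total_assets_def incoming_def lessThan_5 pay_def)

text \<open>Only firm 0 can deviate, and its deviations reach every profile, so equilibria are the
  maximizers of its assets \<open>2 + c\<close>. The full repayment
  \<open>c = \<alpha> + \<beta>\<close> occurs only when firm 1 is served strictly first.\<close>

lemma nash_equilibria_net: "nash_equilibria \<alpha> \<beta> net = {profile [{1}, {2}]}"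
proof -
  let ?u = "\<lambda>t. utility \<alpha> \<beta> net (profile t) 0"
  have best: "?u [{1}, {2}] = 2 + \<alpha> + \<beta>"
    by (simp add: utility_def payments_firm1_first total_assets_pay_0)
  have worse: "?u t < 2 + \<alpha> + \<beta>" if "t \<in> strategies net 0" "t \<noteq> [{1}, {2}]" for t
  proof -
    from that consider "t = [{2}, {1}]" | "t = [{1, 2}]" by (auto simp: strategies_net_0)
    then show ?thesis
    proof cases
      case 1
      then show ?thesis using pos by (simp add: utility_def payments_firm2_first total_assets_pay_0)
    next
      case 2
      obtain a b c where "payments \<alpha> \<beta> net (profile [{1, 2}]) = pay a b c M M 1" "c < \<alpha> + \<beta>"
        by (rule payments_tie)
      with 2 show ?thesis by (simp add: utility_def total_assets_pay_0)
    qed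
  qed
  have upd: "(profile t)(0 := t') = profile t'" for t t' by (auto simp: profile_def)
  have fixed: "(profile t)(i := t') = profile t"
    if "i \<in> {1, 2, 3, 4}" "t' \<in> strategies net i" for t i t'
  proof (rule fun_upd_idem)
    show "profile t i = t'"
      using that by (elim insertE) (simp_all add: profile_def strategies_net)
  qed
  have nash: "profile t \<in> nash_equilibria \<alpha> \<beta> net \<longleftrightarrow> (\<forall>t'\<in>strategies net 0. \<not> ?u t' > ?u t)"
    if "t \<in> strategies net 0" for t
    using that unfolding nash_equilibria_def profiles_net
    by (auto simp: all_less_5 upd fixed)
  have t1: "[{1}, {2}] \<in> strategies net 0" by (simp add: strategies_net_0)
  have "\<not> ?u t > ?u [{1}, {2}]" if "t \<in> strategies net 0" for t
    using best worse[OF that] by (cases "t = [{1}, {2}]") auto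
  then have "profile [{1}, {2}] \<in> nash_equilibria \<alpha> \<beta> net" using nash[OF t1] by blast
  moreover have "s = profile [{1}, {2}]" if s: "s \<in> nash_equilibria \<alpha> \<beta> net" for s
  proof -
    obtain t where t: "s = profile t" "t \<in> strategies net 0"
      using s profiles_net by (auto simp: nash_equilibria_def)
    then have "\<not> ?u [{1}, {2}] > ?u t" using nash[OF t(2)] s t1 by blast
    then show ?thesis using t worse[OF t(2)] best by auto
  qed
  ultimately show ?thesis by blast
qed

lemma price_of_stability_ge: "price_of_stability \<alpha> \<beta> net \<ge> M / 9"
proof -
  let ?W = "\<lambda>s. social_welfare net (payments \<alpha> \<beta> net s)"
  \<comment> \<open>The 9 is 2 + 4 + 2 + 1: external assets, payment of firm 0, repayment of firm 1,
    payment of firm 4.\<close>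
  have W1: "0 < ?W (profile [{1}, {2}])" "?W (profile [{1}, {2}]) \<le> 9"
    using \<beta>_bounds pos unfolding payments_firm1_first social_welfare_pay by auto
  \<comment> \<open>A crude bound: the cycle alone contributes \<open>2 * M\<close>.\<close>
  have "M \<le> ?W (profile [{2}, {1}])"
    using M pos unfolding payments_firm2_first social_welfare_pay by simp
  also have "\<dots> \<le> opt_welfare \<alpha> \<beta> net"
    unfolding opt_welfare_def
    by (intro Max_ge) (auto simp: profiles_net strategies_net_0)
  finally have "M / 9 \<le> opt_welfare \<alpha> \<beta> net / ?W (profile [{1}, {2}])"
    using W1 M by (intro frac_le) auto
  then show ?thesis by (simp add: price_of_stability_def nash_equilibria_net)
qed

end

theorem theorem7:
  fixes \<alpha> \<beta> R :: real
  assumes "\<alpha> \<in> {0..1}" and "\<beta> \<in> {0..1}"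
    and "\<alpha> > 0 \<or> \<beta> > 0"
    and "R > 0"
  shows "\<exists>N :: network. financial_network N \<and>
           nash_equilibria \<alpha> \<beta> N \<noteq> {} \<and>
           price_of_stability \<alpha> \<beta> N \<ge> R"
proof -
  \<comment> \<open>The factor 9 cancels the bound on the equilibrium welfare.\<close>
  interpret detached_cycle \<alpha> \<beta> "9 * R"
    using assms by unfold_locales auto
  show ?thesis
    using financial_network_net nash_equilibria_net price_of_stability_ge by (intro exI[of _ net]) simp
qed

end
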